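(* Let $f\colon X\to\mathbb{R}$ be a filter on a Lefschetz complex $X$ and let $\sigma\in\mathrm{SH}(f)$ be a shallow pair. Then $$\mathrm{SH}(f^{\sigma})\supseteq \mathrm{SH}(f)\setminus\{\sigma\}\quad\text{and}\quad \mathrm{BD}(f^{\sigma})=\mathrm{BD}(f)\setminus\{\sigma\}.$$ In particular, $\mathrm{BD}(f^{\sigma})\cap \mathrm{SH}(f)\subseteq \mathrm{SH}(f^{\sigma})$.
   Context: Fix a field $\mathbb{F}$. A Lefschetz complex is a triple $(X,\dim,\kappa)$ with $X$ a finite set (of cells), $\dim\colon X\to\mathbb{Z}$, and an incidence map $\kappa\colon X\times X\to\mathbb{F}$ such that $\sum_{y\in X}\kappa(z,y)\kappa(y,x)=0$ for all $z,x\in X$, and $\kappa(y,x)\neq 0$ only if $\dim y=\dim x+1$. If $\kappa(y,x)\ne 0$, then $x$ is a facet of $y$ and $y$ is a cofacet of $x$. A filter on $X$ is an injective map $f\colon X\to\mathbb{R}$ with $f(x)<f(y)$ whenever $x$ is a facet of $y$. Birth-death pairs: order $X$ by $f$ and let $\Delta$ be the matrix with rows and columns indexed by $X$ in this order, $\Delta[x,y]=\kappa(y,x)$. A reduced form of $\Delta$ is a matrix $R=\Delta\cdot V$ with $V-\mathrm{Id}$ strictly upper triangular and such that the pivots (lowest non-zero entries) of the non-zero columns of $R$ lie in pairwise different rows. $\mathrm{BD}(f)$ is the set of pairs $(s,t)\in X\times X$ such that column $t$ of $R$ is non-zero and its pivot is in row $s$; this does not depend on the choice of the reduced form $R$. Shallow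 pairs: $\mathrm{SH}(f)$ is the set of pairs $(s,t)$ such that $s$ is a facet of $t$, $f(x)\le f(s)$ for all facets $x$ of $t$, and $f(y)\ge f(t)$ for all cofacets $y$ of $s$. One has $\mathrm{SH}(f)\subseteq\mathrm{BD}(f)$. Cancellation: if $s$ is a facet of $t$, the quotient of $X$ by $(s,t)$ is the Lefschetz complex with cells $X\setminus\{s,t\}$, restricted dimension map, and incidence map $\kappa'(y,x)=\kappa(y,x)-\kappa(t,s)^{-1}\kappa(y,s)\kappa(t,x)$. For $\sigma\in\mathrm{SH}(f)$, $X^{\sigma}$ denotes the quotient of $X$ by $\sigma$, and $f^{\sigma}=f|_{X^{\sigma}}$, which is a filter on $X^{\sigma}$. *)

theory Defs
  imports Complex_Main
begin

text \<open>
  Lefschetz complexes over a field. The dimension map and the incidence map are total functions,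
  but only their values on the cells are meaningful; all notions below look at cells only.
\<close>

record ('a, 'k) complex_data =
  cells :: "'a set"
  cell_dim :: "'a \<Rightarrow> int"
  inc :: "'a \<Rightarrow> 'a \<Rightarrow> 'k"

definition lefschetz_complex :: "('a, 'k::field) complex_data \<Rightarrow> bool" where
  "lefschetz_complex X \<longleftrightarrow>
     finite (cells X) \<and>
     (\<forall>z\<in>cells X. \<forall>x\<in>cells X. (\<Sum>y\<in>cells X. inc X z y * inc X y x) = 0) \<and>
     (\<forall>y\<in>cells X. \<forall>x\<in>cells X. inc X y x \<noteq> 0 \<longrightarrow> cell_dim X y = cell_dim X x + 1)"

definition facet :: "('a, 'k::field) complex_data \<Rightarrow> 'a \<Rightarrow> 'a \<Rightarrow> bool" where
  "facet X x y \<longleftrightarrow> x \<in> cells X \<and> y \<in> cells X \<and> inc X y x \<noteq> 0"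

abbreviation cofacet :: "('a, 'k::field) complex_data \<Rightarrow> 'a \<Rightarrow> 'a \<Rightarrow> bool" where
  "cofacet X y x \<equiv> facet X x y"

definition lefschetz_filter :: "('a, 'k::field) complex_data \<Rightarrow> ('a \<Rightarrow> real) \<Rightarrow> bool" where
  "lefschetz_filter X f \<longleftrightarrow> inj_on f (cells X) \<and> (\<forall>x y. facet X x y \<longrightarrow> f x < f y)"

text \<open>
  Matrices are functions of a row and a column, both indexed by the cells in the order given by
  the filter; thus row \<open>x\<close> lies above row \<open>y\<close> iff \<open>f x < f y\<close>.
\<close>

definition boundary_matrix :: "('a, 'k::field) complex_data \<Rightarrow> 'a \<Rightarrow> 'a \<Rightarrow> 'k" where
  "boundary_matrix X x y = inc X y x"

definition strictly_upper_triangular ::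
  "'a set \<Rightarrow> ('a \<Rightarrow> real) \<Rightarrow> ('a \<Rightarrow> 'a \<Rightarrow> 'k::field) \<Rightarrow> bool" where
  "strictly_upper_triangular A f M \<longleftrightarrow> (\<forall>x\<in>A. \<forall>y\<in>A. M x y \<noteq> 0 \<longrightarrow> f x < f y)"

text \<open>\<open>is_pivot A f R s t\<close>: column \<open>t\<close> of \<open>R\<close> is non-zero and its lowest non-zero entry is in row \<open>s\<close>.\<close>

definition is_pivot ::
  "'a set \<Rightarrow> ('a \<Rightarrow> real) \<Rightarrow> ('a \<Rightarrow> 'a \<Rightarrow> 'k::field) \<Rightarrow> 'a \<Rightarrow> 'a \<Rightarrow> bool" where
  "is_pivot A f R s t \<longleftrightarrow>
     s \<in> A \<and> t \<in> A \<and> R s t \<noteq> 0 \<and> (\<forall>x\<in>A. f s < f x \<longrightarrow> R x t = 0)"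

definition reduced_form ::
  "('a, 'k::field) complex_data \<Rightarrow> ('a \<Rightarrow> real) \<Rightarrow> ('a \<Rightarrow> 'a \<Rightarrow> 'k) \<Rightarrow> bool" where
  "reduced_form X f R \<longleftrightarrow>
     (\<exists>V. strictly_upper_triangular (cells X) f (\<lambda>x y. V x y - (if x = y then 1 else 0)) \<and>
          (\<forall>x\<in>cells X. \<forall>y\<in>cells X. R x y = (\<Sum>z\<in>cells X. boundary_matrix X x z * V z y))) \<and>
     (\<forall>s t t'. is_pivot (cells X) f R s t \<and> is_pivot (cells X) f R s t' \<longrightarrow> t = t')"

text \<open>
  For a filter on a Lefschetz complex a reduced form exists and all reduced forms have the same
  pivots, so the existential quantifier over \<open>R\<close> is only a way to name the common set of pivots.
\<close>

definition BD :: "('a, 'k::field) complex_data \<Rightarrow> ('a \<Rightarrow> real) \<Rightarrow> ('a \<times> 'a) set" where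
  "BD X f = {(s, t). \<exists>R. reduced_form X f R \<and> is_pivot (cells X) f R s t}"

definition SH :: "('a, 'k::field) complex_data \<Rightarrow> ('a \<Rightarrow> real) \<Rightarrow> ('a \<times> 'a) set" where
  "SH X f = {(s, t). facet X s t \<and>
     (\<forall>x. facet X x t \<longrightarrow> f x \<le> f s) \<and> (\<forall>y. cofacet X y s \<longrightarrow> f y \<ge> f t)}"

text \<open>
  The quotient by \<open>(s, t)\<close> is meant for \<open>s\<close> a facet of \<open>t\<close>. A filter on \<open>X\<close> restricts to the
  quotient by being evaluated on the remaining cells only, so the same function \<open>f\<close> represents
  its restriction.
\<close>

definition lefschetz_quotient ::
  "('a, 'k::field) complex_data \<Rightarrow> 'a \<times> 'a \<Rightarrow> ('a, 'k) complex_data" where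
  "lefschetz_quotient X = (\<lambda>(s, t).
     \<lparr> cells = cells X - {s, t},
       cell_dim = cell_dim X,
       inc = (\<lambda>y x. inc X y x - inverse (inc X t s) * inc X y s * inc X t x) \<rparr>)"

end

theory Submission
  imports Defs
begin

text \<open>
  Write \<open>\<sigma> = (s, t)\<close>, \<open>X'\<close> for the quotient, and \<open>D\<close>, \<open>D'\<close> for the two boundary matrices.

  The statement on birth-death pairs holds because cancelling \<open>\<sigma>\<close> amounts to column operations that
  are allowed in a reduction of \<open>D\<close>: away from the columns \<open>s\<close> and \<open>t\<close>, the matrix \<open>D'\<close> arises
  by clearing row \<open>s\<close> with column \<open>t\<close>, and column \<open>t\<close> is added only to columns of cofacets of \<open>s\<close>,
  all of which come after \<open>t\<close> since \<open>\<sigma>\<close> is shallow. Hence a reduced form \<open>R'\<close> of \<open>D'\<close> extends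
  to a reduced form \<open>R\<close> of \<open>D\<close> (lemma \<open>reduced_form_of_quotient\<close>):
  column \<open>t\<close> stays \<open>D[\<cdot>,t]\<close>, whose pivot is \<open>s\<close>; column \<open>s\<close> becomes zero, because \<open>D D[\<cdot>,t] = 0\<close>
  writes it as a combination of the columns of the other facets of \<open>t\<close>, all of which come before
  \<open>s\<close>; row \<open>s\<close> is zero outside column \<open>t\<close>. What remains is row \<open>t\<close>. Every column of \<open>R\<close> is a
  cycle, so for \<open>y \<in> X'\<close> the coefficient of \<open>s\<close> in the boundary of column \<open>y\<close> gives
  \<open>D[s,t] R[t,y] = - (\<Sum>x\<in>X'. D[s,x] R'[x,y])\<close>, where only rows \<open>x\<close> below \<open>t\<close> contribute. So an
  entry in row \<open>t\<close> is never a pivot and never hides one, and the pivots of \<open>R\<close> are those of \<open>R'\<close>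
  together with \<open>\<sigma>\<close>. As all reduced forms of a matrix have the same pivots (lemma
  \<open>is_pivot_reduced_form_unique\<close>) and \<open>D'\<close> has a reduced form (lemma \<open>reduced_form_exists\<close>), the
  claim follows.

  For shallow pairs, the correction term in \<open>\<kappa>'(y,x)\<close> is non-zero only if \<open>s\<close> is a facet of \<open>y\<close>
  and \<open>x\<close> is a facet of \<open>t\<close>; then \<open>f x \<le> f s\<close> and \<open>f t \<le> f y\<close>, which is too far apart in the
  filter to disturb the extremality of another shallow pair.
\<close>

section \<open>Columns, combinations of columns and their lowest entries\<close>

definition mat_vec :: "('a, 'k::field) complex_data \<Rightarrow> ('a \<Rightarrow> 'k) \<Rightarrow> 'a \<Rightarrow> 'k" where
  "mat_vec X w x = (\<Sum>z\<in>cells X. boundary_matrix X x z * w z)"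

definition lowest :: "'a set \<Rightarrow> ('a \<Rightarrow> real) \<Rightarrow> ('a \<Rightarrow> 'k::field) \<Rightarrow> 'a \<Rightarrow> bool" where
  "lowest A f v s \<longleftrightarrow> s \<in> A \<and> v s \<noteq> 0 \<and> (\<forall>x\<in>A. f s < f x \<longrightarrow> v x = 0)"

text \<open>The vectors allowed as column \<open>t\<close> of the matrix \<open>V\<close> in a reduction \<open>R = D V\<close>.\<close>

definition unit_upper :: "'a set \<Rightarrow> ('a \<Rightarrow> real) \<Rightarrow> 'a \<Rightarrow> ('a \<Rightarrow> 'k::field) \<Rightarrow> bool" where
  "unit_upper A f t v \<longleftrightarrow> v t = 1 \<and> (\<forall>x\<in>A. x \<noteq> t \<longrightarrow> v x \<noteq> 0 \<longrightarrow> f x < f t)"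

lemma is_pivot_iff_lowest:
  "is_pivot A f R s t \<longleftrightarrow> t \<in> A \<and> lowest A f (\<lambda>x. R x t) s"
  by (auto simp: is_pivot_def lowest_def)

lemma lowest_cong:
  "(\<And>x. x \<in> A \<Longrightarrow> v x = w x) \<Longrightarrow> lowest A f v s \<longleftrightarrow> lowest A f w s"
  by (auto simp: lowest_def)

lemma lowest_unique:
  assumes "inj_on f A" "lowest A f v s" "lowest A f v s'"
  shows "s = s'"
proof -
  have "\<not> f s < f s'" "\<not> f s' < f s" using assms by (auto simp: lowest_def)
  then show ?thesis using assms by (auto simp: lowest_def inj_on_def)
qed

lemma strictly_upper_triangular_iff_unit_upper:
  "strictly_upper_triangular A f (\<lambda>x y. V x y - (if x = y then 1 else 0)) \<longleftrightarrow>
     (\<forall>y\<in>A. unit_upper A f y (\<lambda>x. V x y))"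
  by (force simp: strictly_upper_triangular_def unit_upper_def)

lemma reduced_form_iff:
  "reduced_form X f R \<longleftrightarrow>
     (\<exists>V. (\<forall>y\<in>cells X. unit_upper (cells X) f y (\<lambda>x. V x y)) \<and>
          (\<forall>x\<in>cells X. \<forall>y\<in>cells X. R x y = mat_vec X (\<lambda>z. V z y) x)) \<and>
     (\<forall>s t t'. is_pivot (cells X) f R s t \<and> is_pivot (cells X) f R s t' \<longrightarrow> t = t')"
  by (simp add: reduced_form_def strictly_upper_triangular_iff_unit_upper mat_vec_def)

lemma mat_vec_diff:
  "mat_vec X (\<lambda>z. v z - c * w z) x = mat_vec X v x - c * mat_vec X w x"
  by (simp add: mat_vec_def algebra_simps sum_subtractf sum_distrib_left)

lemma mat_vec_cong:
  "(\<And>z. z \<in> cells X \<Longrightarrow> v z = w z) \<Longrightarrow> mat_vec X v x = mat_vec X w x"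
  by (auto simp: mat_vec_def intro: sum.cong)

lemma mat_vec_sum:
  "mat_vec X (\<lambda>z. \<Sum>y\<in>B. V z y * c y) x = (\<Sum>y\<in>B. mat_vec X (\<lambda>z. V z y) x * c y)"
  unfolding mat_vec_def sum_distrib_left sum_distrib_right
  by (subst sum.swap) (simp add: mult.assoc)

lemma lowest_exists:
  assumes "finite A" "x \<in> A" "v x \<noteq> 0"
  shows "\<exists>s. lowest A f v s"
proof -
  let ?S = "{x\<in>A. v x \<noteq> 0}"
  have fin: "finite ?S" "?S \<noteq> {}" using assms by auto
  then obtain s where s: "s \<in> ?S" "\<forall>y\<in>?S. f y \<le> f s"
    using Max_in[of "f ` ?S"] Max_ge[of "f ` ?S"] by fastforce
  then have "lowest A f v s" unfolding lowest_def by force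
  then show ?thesis ..
qed

section \<open>Existence of a reduced form\<close>

text \<open>
  No reduction algorithm is needed: choose every column of \<open>V\<close> so that the lowest non-zero
  entry of the resulting column of \<open>D V\<close> is as high up as possible. If two columns
  had the same pivot, a multiple of the earlier one could be subtracted from the later one,
  contradicting minimality.
\<close>

lemma reduced_form_exists:
  fixes X :: "('a, 'k::field) complex_data"
  assumes fin: "finite (cells X)" and inj: "inj_on f (cells X)"
  shows "\<exists>R. reduced_form X f R"
proof -
  let ?A = "cells X"
  \<comment> \<open>The rows down to the lowest non-zero entry; none for a zero column, which is thus preferred.\<close>
  define S where "S v = {x\<in>?A. \<exists>z\<in>?A. f x \<le> f z \<and> mat_vec X v z \<noteq> 0}" for v
  have finS: "finite (S v)" for v using fin by (simp add: S_def)
  have "\<exists>v. unit_upper ?A f t v \<and> (\<forall>w. unit_upper ?A f t w \<longrightarrow> card (S v) \<le> card (S w))" for t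
  proof -
    have "unit_upper ?A f t (\<lambda>x. if x = t then 1 else 0)" by (simp add: unit_upper_def)
    then show ?thesis
      using ex_has_least_nat[of "unit_upper ?A f t" _ "\<lambda>v. card (S v)"] by blast
  qed
  then obtain V where V: "\<And>t. unit_upper ?A f t (V t)"
    and Vmin: "\<And>t w. unit_upper ?A f t w \<Longrightarrow> card (S (V t)) \<le> card (S w)"
    by metis
  define R where "R x y = mat_vec X (V y) x" for x y
  have no_clash: False
    if p: "is_pivot ?A f R s t" "is_pivot ?A f R s t'" and lt: "f t' < f t" for s t t'
  proof -
    have A: "s \<in> ?A" "t \<in> ?A" "t' \<in> ?A" and nz: "R s t \<noteq> 0" "R s t' \<noteq> 0"
      and above: "\<And>x. x \<in> ?A \<Longrightarrow> f s < f x \<Longrightarrow> R x t = 0 \<and> R x t' = 0"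
      using p by (auto simp: is_pivot_def)
    define w where "w = (\<lambda>z. V t z - R s t / R s t' * V t' z)"
    have "V t' t = 0" using V[of t'] lt A by (auto simp: unit_upper_def)
    moreover have "f x < f t" if x: "x \<in> ?A" "x \<noteq> t" "w x \<noteq> 0" for x
    proof (cases "V t x = 0")
      case True
      then have "V t' x \<noteq> 0" using x by (auto simp: w_def)
      then have "f x \<le> f t'" using V[of t'] x by (cases "x = t'") (auto simp: unit_upper_def)
      then show ?thesis using lt by simp
    qed (use V[of t] x in \<open>auto simp: unit_upper_def\<close>)
    ultimately have w: "unit_upper ?A f t w" using V[of t] by (auto simp: unit_upper_def w_def)
    have mw: "mat_vec X w x = R x t - R s t / R s t' * R x t'" for x
      unfolding w_def R_def by (rule mat_vec_diff)
    have lo: "f z < f s" if z: "z \<in> ?A" "mat_vec X w z \<noteq> 0" for z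
    proof -
      have "z \<noteq> s" using z nz by (auto simp: mw)
      moreover have "\<not> f s < f z" using z above[of z] by (auto simp: mw)
      ultimately show ?thesis using inj A z by (metis inj_onD linorder_neqE_linordered_idom)
    qed
    have "f x \<le> f s" if "x \<in> S w" for x using that lo by (force simp: S_def)
    then have "S w \<subseteq> S (V t)" using A nz by (auto simp: S_def R_def)
    moreover have "s \<in> S (V t)" using A nz by (auto simp: S_def R_def)
    moreover have "s \<notin> S w" using lo by (force simp: S_def)
    ultimately have "card (S w) < card (S (V t))"
      using finS by (metis psubsetI psubset_card_mono)
    then show False using Vmin[OF w] by simp
  qed
  have "reduced_form X f R"
    unfolding reduced_form_iff
  proof (intro conjI allI impI)
    show "\<exists>V. (\<forall>y\<in>?A. unit_upper ?A f y (\<lambda>x. V x y)) \<and>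
          (\<forall>x\<in>?A. \<forall>y\<in>?A. R x y = mat_vec X (\<lambda>z. V z y) x)"
      by (rule exI[of _ "\<lambda>x y. V y x"]) (simp add: V R_def)
  next
    fix s t t' assume p: "is_pivot ?A f R s t \<and> is_pivot ?A f R s t'"
    then have "\<not> f t < f t'" "\<not> f t' < f t" using no_clash by blast+
    then show "t = t'" using p inj by (auto simp: is_pivot_def inj_on_def)
  qed
  then show ?thesis by blast
qed

section \<open>Uniqueness of the pivots\<close>

text \<open>
  Unitriangular matrices are invertible, and inverting one does not enlarge initial segments.
  Back substitution removes the last cell of the support of \<open>w\<close> with the column that it leads.
\<close>

lemma unit_upper_columns_span:
  fixes V :: "'a \<Rightarrow> 'a \<Rightarrow> 'k::field"
  assumes fin: "finite A" and inj: "inj_on f A"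
    and V: "\<And>y. y \<in> A \<Longrightarrow> unit_upper A f y (\<lambda>x. V x y)"
    and supp: "\<And>x. x \<in> A \<Longrightarrow> w x \<noteq> 0 \<Longrightarrow> f x \<le> b"
  shows "\<exists>c. (\<forall>x\<in>A. w x = (\<Sum>y\<in>A. V x y * c y)) \<and> (\<forall>y\<in>A. c y \<noteq> 0 \<longrightarrow> f y \<le> b)"
  using supp
proof (induction "card {x\<in>A. f x \<le> b}" arbitrary: w b rule: less_induct)
  case less
  show ?case
  proof (cases "\<exists>x\<in>A. w x \<noteq> 0")
    case False
    then show ?thesis by (intro exI[of _ "\<lambda>_. 0"]) auto
  next
    case True
    then obtain m where m: "lowest A f w m" using lowest_exists[OF fin] by blast
    then have mA: "m \<in> A" and mb: "f m \<le> b" using less.prems by (auto simp: lowest_def)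
    have delta: "(\<Sum>y\<in>A. V x y * (if y = m then w m else 0)) = V x m * w m" for x
      using sum.remove[OF fin mA, of "\<lambda>y. V x y * (if y = m then w m else 0)"] by simp
    define w' where "w' x = w x - w m * V x m" for x
    have w': "f x < f m" if x: "x \<in> A" "w' x \<noteq> 0" for x
    proof (rule ccontr)
      assume "\<not> f x < f m"
      moreover have "x \<noteq> m" using x V[OF mA] by (auto simp: w'_def unit_upper_def)
      ultimately have "f m < f x" using inj x mA by (metis inj_onD linorder_neqE_linordered_idom)
      then have "w x = 0" "V x m = 0"
        using m V[OF mA] x \<open>x \<noteq> m\<close> by (auto simp: lowest_def unit_upper_def)
      then show False using x by (simp add: w'_def)
    qed
    show ?thesis
    proof (cases "\<exists>x\<in>A. w' x \<noteq> 0")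
      case False
      then have "w x = (\<Sum>y\<in>A. V x y * (if y = m then w m else 0))" if "x \<in> A" for x
        using that by (simp only: delta) (simp add: w'_def)
      then show ?thesis using mb by (intro exI[of _ "\<lambda>y. if y = m then w m else 0"]) auto
    next
      case True
      then obtain m' where m': "lowest A f w' m'" using lowest_exists[OF fin] by blast
      then have m'A: "m' \<in> A" and m'm: "f m' < f m" using w' by (auto simp: lowest_def)
      have "{x\<in>A. f x \<le> f m'} \<subset> {x\<in>A. f x \<le> b}" using mb m'm mA by force
      then have "card {x\<in>A. f x \<le> f m'} < card {x\<in>A. f x \<le> b}"
        using fin by (intro psubset_card_mono) auto
      moreover have "f x \<le> f m'" if "x \<in> A" "w' x \<noteq> 0" for x
        using m' that by (force simp: lowest_def)
      ultimately obtain c where c: "\<forall>x\<in>A. w' x = (\<Sum>y\<in>A. V x y * c y)"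
        "\<forall>y\<in>A. c y \<noteq> 0 \<longrightarrow> f y \<le> f m'"
        using less.hyps[of "f m'" w'] by blast
      have "w x = (\<Sum>y\<in>A. V x y * (c y + (if y = m then w m else 0)))" if "x \<in> A" for x
      proof -
        have "w x = w' x + V x m * w m" by (simp add: w'_def)
        then show ?thesis
          using that c(1) by (simp only: distrib_left sum.distrib delta)
      qed
      then show ?thesis using c(2) mb m'm
        by (intro exI[of _ "\<lambda>y. c y + (if y = m then w m else 0)"]) force
    qed
  qed
qed

text \<open>
  In a combination of columns with distinct pivots, the lowest of the pivots involved cannot
  cancel. Thus row \<open>s\<close> contains a pivot of \<open>R\<close> at or before \<open>b\<close> as soon as \<open>s\<close> is the lowest entry
  of some combination of the columns of \<open>D\<close> up to \<open>b\<close>, a condition that does not mention \<open>R\<close>.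
\<close>

lemma reduced_form_captures_lowest:
  fixes X :: "('a, 'k::field) complex_data"
  assumes fin: "finite (cells X)" and inj: "inj_on f (cells X)" and red: "reduced_form X f R"
    and low: "lowest (cells X) f (mat_vec X w) s"
    and supp: "\<And>x. x \<in> cells X \<Longrightarrow> w x \<noteq> 0 \<Longrightarrow> f x \<le> b"
  shows "\<exists>y. is_pivot (cells X) f R s y \<and> f y \<le> b"
proof -
  let ?A = "cells X"
  obtain V where V: "\<And>y. y \<in> ?A \<Longrightarrow> unit_upper ?A f y (\<lambda>x. V x y)"
    and R: "\<And>x y. x \<in> ?A \<Longrightarrow> y \<in> ?A \<Longrightarrow> R x y = mat_vec X (\<lambda>z. V z y) x"
    and distinct: "\<And>s t t'. is_pivot ?A f R s t \<Longrightarrow> is_pivot ?A f R s t' \<Longrightarrow> t = t'"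
    using red unfolding reduced_form_iff by blast
  obtain c where c: "\<forall>x\<in>?A. w x = (\<Sum>y\<in>?A. V x y * c y)" "\<forall>y\<in>?A. c y \<noteq> 0 \<longrightarrow> f y \<le> b"
    using unit_upper_columns_span[OF fin inj V, of w b] supp by blast
  have mw: "mat_vec X w x = (\<Sum>y\<in>?A. R x y * c y)" if x: "x \<in> ?A" for x
  proof -
    have "mat_vec X w x = mat_vec X (\<lambda>z. \<Sum>y\<in>?A. V z y * c y) x"
      using c by (intro mat_vec_cong) auto
    then show ?thesis using R x by (simp add: mat_vec_sum)
  qed
  define P where "P = {p\<in>?A. \<exists>y\<in>?A. c y \<noteq> 0 \<and> is_pivot ?A f R p y}"
  have col: "\<exists>p\<in>P. lowest ?A f (\<lambda>x. R x y) p" if y: "x \<in> ?A" "y \<in> ?A" "R x y * c y \<noteq> 0" for x y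
  proof -
    obtain p where "lowest ?A f (\<lambda>x. R x y) p"
      using lowest_exists[OF fin y(1), of "\<lambda>x. R x y" f] y by auto
    moreover from this have "p \<in> ?A" by (simp add: lowest_def)
    ultimately show ?thesis using y unfolding P_def is_pivot_iff_lowest by auto
  qed
  have "s \<in> ?A" "mat_vec X w s \<noteq> 0" using low by (auto simp: lowest_def)
  then have "(\<Sum>y\<in>?A. R s y * c y) \<noteq> 0" using mw[of s] by simp
  then obtain y0 where "y0 \<in> ?A" "R s y0 * c y0 \<noteq> 0"
    by (rule sum.not_neutral_contains_not_neutral)
  then have "P \<noteq> {}" using col \<open>s \<in> ?A\<close> by blast
  moreover have "finite P" using fin by (simp add: P_def)
  ultimately obtain p where p: "p \<in> P" and pmax: "\<forall>q\<in>P. f q \<le> f p"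
    using Max_in[of "f ` P"] Max_ge[of "f ` P"] by fastforce
  obtain y where y: "y \<in> ?A" "c y \<noteq> 0" "is_pivot ?A f R p y" using p by (auto simp: P_def)
  have pA: "p \<in> ?A" using p by (simp add: P_def)
  have zero: "R x y' * c y' = 0" if x: "x \<in> ?A" "y' \<in> ?A" and "f p < f x \<or> x = p \<and> y' \<noteq> y" for x y'
  proof (rule ccontr)
    assume nz: "R x y' * c y' \<noteq> 0"
    then obtain q where q: "q \<in> P" "lowest ?A f (\<lambda>x. R x y') q" using col x by blast
    have "f q \<le> f p" using q pmax by blast
    moreover have "f x \<le> f q" using q(2) nz x by (force simp: lowest_def)
    ultimately have "x = p" "y' \<noteq> y" "f q = f p" using that by auto
    then have "q = p" using inj pA q by (auto simp: inj_on_def lowest_def)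
    then have "y' = y" using distinct[of p y' y] q(2) x(2) y(3) by (simp add: is_pivot_iff_lowest)
    then show False using \<open>y' \<noteq> y\<close> by simp
  qed
  have "mat_vec X w p = R p y * c y"
    using mw[OF pA] zero[OF pA] sum.remove[OF fin y(1), of "\<lambda>y. R p y * c y"] by simp
  then have "mat_vec X w p \<noteq> 0" using y by (simp add: is_pivot_def)
  moreover have "mat_vec X w x = 0" if "x \<in> ?A" "f p < f x" for x
    unfolding mw[OF that(1)] by (rule sum.neutral) (use zero that in blast)
  ultimately have "lowest ?A f (mat_vec X w) p" using pA by (simp add: lowest_def)
  then have "p = s" by (rule lowest_unique[OF inj _ low])
  then show ?thesis using y c by blast
qed

text \<open>
  By \<open>reduced_form_captures_lowest\<close>, a pivot of \<open>R1\<close> in row \<open>s\<close> and column \<open>t\<close> forces \<open>R2\<close> to have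
  one in row \<open>s\<close> and a column not after \<open>t\<close>, and vice versa; so the two columns agree.
\<close>

lemma is_pivot_reduced_form_unique:
  fixes X :: "('a, 'k::field) complex_data"
  assumes fin: "finite (cells X)" and inj: "inj_on f (cells X)"
    and red: "reduced_form X f R1" "reduced_form X f R2"
    and piv: "is_pivot (cells X) f R1 s t"
  shows "is_pivot (cells X) f R2 s t"
proof -
  let ?A = "cells X"
  have move: "\<exists>y'. is_pivot ?A f R' s y' \<and> f y' \<le> f y"
    if R: "reduced_form X f R" "reduced_form X f R'" and p: "is_pivot ?A f R s y" for R R' y
  proof -
    have yA: "y \<in> ?A" using p by (simp add: is_pivot_def)
    obtain V where V: "unit_upper ?A f y (\<lambda>x. V x y)"
      and Rv: "\<And>x. x \<in> ?A \<Longrightarrow> R x y = mat_vec X (\<lambda>z. V z y) x"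
      using R(1) yA unfolding reduced_form_iff by blast
    have "lowest ?A f (\<lambda>x. R x y) s" using p by (simp add: is_pivot_iff_lowest)
    then have "lowest ?A f (mat_vec X (\<lambda>z. V z y)) s"
      using lowest_cong[of ?A "\<lambda>x. R x y" "mat_vec X (\<lambda>z. V z y)" f s, OF Rv] by simp
    moreover have "f x \<le> f y" if "x \<in> ?A" "V x y \<noteq> 0" for x
      using V that by (cases "x = y") (auto simp: unit_upper_def)
    ultimately show ?thesis by (rule reduced_form_captures_lowest[OF fin inj R(2)])
  qed
  obtain y where y: "is_pivot ?A f R2 s y" "f y \<le> f t" using move[OF red piv] by blast
  obtain t' where t': "is_pivot ?A f R1 s t'" "f t' \<le> f y" using move[OF red(2,1) y(1)] by blast
  have "t' = t" using red(1) t'(1) piv unfolding reduced_form_iff by blast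
  then have "f y = f t" using y t' by simp
  then have "y = t" using inj y piv by (auto simp: inj_on_def is_pivot_def)
  then show ?thesis using y by simp
qed

section \<open>Shallow pairs and cancellation\<close>

text \<open>
  If \<open>(s, t)\<close> and \<open>(t, b)\<close> were both shallow, then \<open>t\<close> would be the only cell between \<open>b\<close> and \<open>s\<close>,
  so the incidence numbers along this path could not cancel.
\<close>

lemma SH_no_consecutive:
  assumes X: "lefschetz_complex X" and f: "lefschetz_filter X f"
    and st: "(s, t) \<in> SH X f" and tb: "(t, b) \<in> SH X f"
  shows False
proof -
  have A: "s \<in> cells X" "t \<in> cells X" "b \<in> cells X" and nz: "inc X b t * inc X t s \<noteq> 0"
    using st tb by (auto simp: SH_def facet_def)
  have zero: "inc X b y * inc X y s = 0" if y: "y \<in> cells X" "y \<noteq> t" for y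
  proof (rule ccontr)
    assume "inc X b y * inc X y s \<noteq> 0"
    then have "facet X y b" "facet X s y" using A y by (auto simp: facet_def)
    then have "f y = f t" using st tb by (fastforce simp: SH_def)
    then show False using f A y by (auto simp: lefschetz_filter_def inj_on_def)
  qed
  have "(\<Sum>y\<in>cells X - {t}. inc X b y * inc X y s) = 0"
    by (rule sum.neutral) (use zero in blast)
  then have "(\<Sum>y\<in>cells X. inc X b y * inc X y s) = inc X b t * inc X t s"
    using X sum.remove[of "cells X" t "\<lambda>y. inc X b y * inc X y s"] A
    by (simp add: lefschetz_complex_def)
  then show False using X A nz by (simp add: lefschetz_complex_def)
qed

text \<open>
  Within a shallow pair each cell determines the other: \<open>t\<close> is the first cofacet of \<open>s\<close>, and \<open>s\<close>
  is the last facet of \<open>t\<close>.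
\<close>

lemma SH_disjoint:
  assumes X: "lefschetz_complex X" and f: "lefschetz_filter X f"
    and st: "(s, t) \<in> SH X f" and ab: "(a, b) \<in> SH X f" and ne: "(a, b) \<noteq> (s, t)"
  shows "a \<noteq> s" "a \<noteq> t" "b \<noteq> s" "b \<noteq> t"
proof -
  have A: "s \<in> cells X" "t \<in> cells X" "a \<in> cells X" "b \<in> cells X"
    and inj: "inj_on f (cells X)"
    using st ab f by (auto simp: SH_def facet_def lefschetz_filter_def)
  show "a \<noteq> t" "b \<noteq> s" using SH_no_consecutive[OF X f] st ab by blast+
  show "a \<noteq> s"
  proof
    assume "a = s"
    then have "f b = f t" using st ab by (fastforce simp: SH_def)
    then show False using inj A ne \<open>a = s\<close> by (auto simp: inj_on_def)
  qed
  show "b \<noteq> t"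
  proof
    assume "b = t"
    then have "f a = f s" using st ab by (fastforce simp: SH_def)
    then show False using inj A ne \<open>b = t\<close> by (auto simp: inj_on_def)
  qed
qed

lemma cells_lefschetz_quotient: "cells (lefschetz_quotient X (s, t)) = cells X - {s, t}"
  by (simp add: lefschetz_quotient_def)

lemma inc_lefschetz_quotient:
  "inc (lefschetz_quotient X (s, t)) y x = inc X y x - inverse (inc X t s) * inc X y s * inc X t x"
  by (simp add: lefschetz_quotient_def)

text \<open>
  The correction term cannot create a facet of \<open>b\<close> after \<open>a\<close>: a new facet \<open>x\<close> of \<open>b\<close> requires
  \<open>s\<close> to be a facet of \<open>b\<close> and \<open>x\<close> a facet of \<open>t\<close>, whence \<open>f x \<le> f s \<le> f a\<close>; dually for the
  cofacets of \<open>a\<close>. Nor can it cancel \<open>\<kappa>(b,a)\<close>, as \<open>s\<close> being a facet of \<open>b\<close> and \<open>a\<close> one of \<open>t\<close>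
  would give \<open>f b = f t\<close>.
\<close>

lemma SH_lefschetz_quotient_supset:
  assumes X: "lefschetz_complex X" and f: "lefschetz_filter X f" and st: "(s, t) \<in> SH X f"
  shows "SH X f - {(s, t)} \<subseteq> SH (lefschetz_quotient X (s, t)) f"
proof (rule subrelI)
  fix a b assume "(a, b) \<in> SH X f - {(s, t)}"
  then have ab: "(a, b) \<in> SH X f" and ne: "(a, b) \<noteq> (s, t)" by simp_all
  let ?Q = "lefschetz_quotient X (s, t)"
  note dis = SH_disjoint[OF X f st ab ne]
  have A: "a \<in> cells X" "b \<in> cells X" "s \<in> cells X" "t \<in> cells X" and inj: "inj_on f (cells X)"
    using st ab f by (auto simp: SH_def facet_def lefschetz_filter_def)
  have facetD: "facet X x y \<or> facet X s y \<and> facet X x t" if "facet ?Q x y" for x y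
    using that A
    by (auto simp: facet_def cells_lefschetz_quotient inc_lefschetz_quotient)
  have "inc X b s * inc X t a = 0"
  proof (rule ccontr)
    assume "inc X b s * inc X t a \<noteq> 0"
    then have "facet X s b" "facet X a t" using A by (auto simp: facet_def)
    then have "f b = f t" using st ab by (fastforce simp: SH_def)
    then show False using inj A dis by (auto simp: inj_on_def)
  qed
  then have "facet ?Q a b"
    using ab dis by (auto simp: SH_def facet_def cells_lefschetz_quotient inc_lefschetz_quotient)
  moreover have "f x \<le> f a" if "facet ?Q x b" for x
    using facetD[OF that] st ab by (fastforce simp: SH_def)
  moreover have "f b \<le> f y" if "facet ?Q a y" for y
    using facetD[OF that] st ab by (fastforce simp: SH_def)
  ultimately show "(a, b) \<in> SH ?Q f" by (simp add: SH_def)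
qed

section \<open>Birth-death pairs and cancellation\<close>

lemma mat_vec_mat_vec:
  assumes X: "lefschetz_complex X" and x: "x \<in> cells X"
  shows "mat_vec X (mat_vec X w) x = 0"
proof -
  have "mat_vec X (mat_vec X w) x =
        (\<Sum>z\<in>cells X. \<Sum>y\<in>cells X. inc X z x * (inc X y z * w y))"
    by (simp add: mat_vec_def boundary_matrix_def sum_distrib_left)
  also have "\<dots> = (\<Sum>y\<in>cells X. \<Sum>z\<in>cells X. inc X z x * (inc X y z * w y))"
    by (rule sum.swap)
  also have "\<dots> = (\<Sum>y\<in>cells X. w y * (\<Sum>z\<in>cells X. inc X y z * inc X z x))"
    by (simp add: sum_distrib_left ac_simps)
  also have "\<dots> = 0" using X x by (simp add: lefschetz_complex_def)
  finally show ?thesis .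
qed

text \<open>
  The witness \<open>V\<close> extends the matrix \<open>V'\<close> that reduces the quotient. Its column \<open>t\<close> is the unit
  vector, its column \<open>s\<close> is the normalised boundary of \<open>t\<close>, which is a cycle with leading cell
  \<open>s\<close>, and in the other columns the entry in row \<open>t\<close> is the multiple of column \<open>t\<close> that clears
  row \<open>s\<close>.
\<close>

lemma reduced_form_of_quotient:
  fixes X :: "('a, 'k::field) complex_data"
  assumes X: "lefschetz_complex X" and f: "lefschetz_filter X f" and st: "(s, t) \<in> SH X f"
    and red: "reduced_form (lefschetz_quotient X (s, t)) f R'"
  shows "\<exists>R. reduced_form X f R \<and>
    (\<forall>a b. is_pivot (cells X) f R a b \<longleftrightarrow>
       is_pivot (cells X - {s, t}) f R' a b \<or> (a, b) = (s, t))"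
proof -
  let ?A = "cells X" and ?B = "cells X - {s, t}"
  let ?Q = "lefschetz_quotient X (s, t)"
  have A: "s \<in> ?A" "t \<in> ?A" and k: "inc X t s \<noteq> 0" and fin: "finite ?A"
    and inj: "inj_on f ?A" and finB: "finite ?B"
    and mono: "\<And>x y. facet X x y \<Longrightarrow> f x < f y"
    using X st f by (auto simp: SH_def facet_def lefschetz_filter_def lefschetz_complex_def)
  have sltt: "f s < f t" and ne: "s \<noteq> t" using st mono[of s t] by (auto simp: SH_def)
  have strict: "f x < f y" if "f x \<le> f y" "x \<in> ?A" "y \<in> ?A" "x \<noteq> y" for x y
    using that inj by (metis inj_onD order_less_le)
  have below_s: "f x < f s" if "x \<in> ?A" "x \<noteq> s" "inc X t x \<noteq> 0" for x
    using st that A strict by (auto simp: SH_def facet_def)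
  have above_t: "f t < f y" if "y \<in> ?A" "y \<noteq> t" "inc X y s \<noteq> 0" for y
    using st that A strict by (auto simp: SH_def facet_def)
  have self: "inc X x x = 0" if "x \<in> ?A" for x using mono[of x x] that by (auto simp: facet_def)
  have split: "(\<Sum>z\<in>?A. g z) = g s + g t + (\<Sum>z\<in>?B. g z)" for g :: "'a \<Rightarrow> 'k"
  proof -
    have "?A = insert s (insert t ?B)" using A by auto
    then have "(\<Sum>z\<in>?A. g z) = (\<Sum>z\<in>insert s (insert t ?B). g z)" by simp
    also have "\<dots> = g s + g t + (\<Sum>z\<in>?B. g z)" using finB ne by (simp add: add.assoc)
    finally show ?thesis .
  qed
  obtain V' where V': "\<And>y. y \<in> ?B \<Longrightarrow> unit_upper ?B f y (\<lambda>x. V' x y)"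
    and R': "\<And>x y. x \<in> ?B \<Longrightarrow> y \<in> ?B \<Longrightarrow> R' x y = mat_vec ?Q (\<lambda>z. V' z y) x"
    and distinct: "\<And>s t t'. is_pivot ?B f R' s t \<Longrightarrow> is_pivot ?B f R' s t' \<Longrightarrow> t = t'"
    using red unfolding reduced_form_iff cells_lefschetz_quotient by blast
  define e where "e y = - inverse (inc X t s) * (\<Sum>z\<in>?B. inc X z s * V' z y)" for y
  define V where "V x y =
    (if y = t then (if x = t then 1 else 0)
     else if y = s then inverse (inc X t s) * inc X t x
     else if x = t then e y else if x = s then 0 else V' x y)" for x y
  define R where "R x y = mat_vec X (\<lambda>z. V z y) x" for x y
  have V: "unit_upper ?A f y (\<lambda>x. V x y)" if y: "y \<in> ?A" for y
  proof -
    consider "y = t" | "y = s" | "y \<in> ?B" using y by auto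
    then show ?thesis
    proof cases
      case 1 then show ?thesis by (simp add: unit_upper_def V_def)
    next
      case 2 then show ?thesis using ne k below_s by (simp add: unit_upper_def V_def)
    next
      case 3
      have "f t < f y" if "e y \<noteq> 0"
      proof -
        have "(\<Sum>z\<in>?B. inc X z s * V' z y) \<noteq> 0" using that by (auto simp: e_def)
        then obtain z where z: "z \<in> ?B" "inc X z s * V' z y \<noteq> 0"
          by (rule sum.not_neutral_contains_not_neutral)
        then have "f t < f z" using above_t by auto
        also have "f z \<le> f y" using z V'[OF 3] by (cases "z = y") (auto simp: unit_upper_def)
        finally show ?thesis .
      qed
      then show ?thesis using 3 V'[OF 3] by (auto simp: unit_upper_def V_def)
    qed
  qed
  have Rt: "R x t = inc X t x" for x
    using sum.remove[OF fin A(2), of "\<lambda>z. inc X z x * V z t"]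
    by (simp add: R_def V_def mat_vec_def boundary_matrix_def)
  have Rs: "R x s = 0" if x: "x \<in> ?A" for x
  proof -
    have "R x s = inverse (inc X t s) * (\<Sum>z\<in>?A. inc X t z * inc X z x)"
      using ne by (simp add: R_def V_def mat_vec_def boundary_matrix_def sum_distrib_left ac_simps)
    then show ?thesis using X x A by (simp add: lefschetz_complex_def)
  qed
  \<comment> \<open>The incidence map of the quotient also makes sense in the rows \<open>s\<close> and \<open>t\<close>.\<close>
  have Ry: "R x y = (\<Sum>z\<in>?B. inc ?Q z x * V' z y)" if y: "y \<in> ?B" for x y
  proof -
    have "R x y = inc X t x * e y + (\<Sum>z\<in>?B. inc X z x * V z y)"
      unfolding R_def mat_vec_def boundary_matrix_def using y ne by (subst split) (simp add: V_def)
    also have "(\<Sum>z\<in>?B. inc X z x * V z y) = (\<Sum>z\<in>?B. inc X z x * V' z y)"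
      using y by (intro sum.cong) (auto simp: V_def)
    finally show ?thesis
      by (simp add: e_def inc_lefschetz_quotient algebra_simps sum_subtractf sum_distrib_left sum_negf)
  qed
  have RB: "R x y = R' x y" if "x \<in> ?B" "y \<in> ?B" for x y
    using that by (simp add: Ry R' mat_vec_def boundary_matrix_def cells_lefschetz_quotient)
  have Rsy: "R s y = 0" if "y \<in> ?B" for y
    unfolding Ry[OF that] by (rule sum.neutral) (use k in \<open>simp add: inc_lefschetz_quotient\<close>)
  \<comment> \<open>Columns of \<open>R\<close> are cycles; read off the coefficient of \<open>s\<close> in their boundary.\<close>
  have Rty: "\<exists>x\<in>?B. f t < f x \<and> R' x y \<noteq> 0" if y: "y \<in> ?B" and nz: "R t y \<noteq> 0" for y
  proof -
    have "(\<Sum>x\<in>?A. inc X x s * R x y) = 0"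
      using mat_vec_mat_vec[OF X A(1), of "\<lambda>z. V z y"]
      by (simp add: R_def mat_vec_def boundary_matrix_def)
    then have "inc X t s * R t y + (\<Sum>x\<in>?B. inc X x s * R x y) = 0"
      using self[OF A(1)] by (subst (asm) split) simp
    then have "(\<Sum>x\<in>?B. inc X x s * R x y) \<noteq> 0" using k nz by auto
    then obtain x where x: "x \<in> ?B" "inc X x s * R x y \<noteq> 0"
      by (rule sum.not_neutral_contains_not_neutral)
    then show ?thesis using above_t[of x] RB[OF x(1) y] by auto
  qed
  have piv: "is_pivot ?A f R a b \<longleftrightarrow> is_pivot ?B f R' a b \<or> (a, b) = (s, t)" for a b
  proof -
    consider "b \<notin> ?A" | "b = t" | "b = s" | "b \<in> ?B" by auto
    then show ?thesis
    proof cases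
      case 1 then show ?thesis using A by (auto simp: is_pivot_def)
    next
      case 2
      have "lowest ?A f (\<lambda>x. R x t) s"
        using A k below_s by (force simp: lowest_def Rt)
      then have "lowest ?A f (\<lambda>x. R x t) a \<longleftrightarrow> a = s" using lowest_unique[OF inj] by blast
      then show ?thesis using 2 A by (auto simp: is_pivot_iff_lowest)
    next
      case 3 then show ?thesis using Rs ne by (auto simp: is_pivot_def)
    next
      case 4
      have "is_pivot ?A f R a b" if p: "is_pivot ?B f R' a b"
      proof -
        have a: "a \<in> ?B" "R' a b \<noteq> 0" and lo: "\<And>x. x \<in> ?B \<Longrightarrow> f a < f x \<Longrightarrow> R' x b = 0"
          using p by (auto simp: is_pivot_def)
        have "R t b = 0" if "f a < f t" using Rty[OF 4] lo that by force
        then have "R x b = 0" if "x \<in> ?A" "f a < f x" for x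
          using that lo RB[of x b] Rsy 4 by (cases "x = s \<or> x = t") auto
        then show ?thesis using a RB[OF a(1) 4] 4 by (auto simp: is_pivot_def)
      qed
      moreover have "is_pivot ?B f R' a b" if p: "is_pivot ?A f R a b"
      proof -
        have a: "a \<in> ?A" "R a b \<noteq> 0" and lo: "\<And>x. x \<in> ?A \<Longrightarrow> f a < f x \<Longrightarrow> R x b = 0"
          using p by (auto simp: is_pivot_def)
        have "a \<noteq> s" using a Rsy 4 by auto
        moreover have "a \<noteq> t"
        proof
          assume "a = t"
          then obtain x where "x \<in> ?B" "f a < f x" "R' x b \<noteq> 0" using a Rty[OF 4] by blast
          then show False using lo[of x] RB[of x b] 4 by simp
        qed
        ultimately have "a \<in> ?B" using a by auto
        moreover have "R' x b = 0" if "x \<in> ?B" "f a < f x" for x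
          using lo[of x] RB[of x b] that 4 by simp
        ultimately show ?thesis using a(2) RB[of a b] 4 by (simp add: is_pivot_def)
      qed
      ultimately show ?thesis using 4 by auto
    qed
  qed
  have "reduced_form X f R"
    unfolding reduced_form_iff
  proof (intro conjI allI impI)
    show "\<exists>V. (\<forall>y\<in>?A. unit_upper ?A f y (\<lambda>x. V x y)) \<and>
          (\<forall>x\<in>?A. \<forall>y\<in>?A. R x y = mat_vec X (\<lambda>z. V z y) x)"
      using V by (intro exI[of _ V]) (simp add: R_def)
  next
    fix a b b' assume p: "is_pivot ?A f R a b \<and> is_pivot ?A f R a b'"
    show "b = b'"
    proof (cases "a = s")
      case True
      then have "\<not> is_pivot ?B f R' a c" for c by (simp add: is_pivot_def)
      then show ?thesis using p by (simp add: piv)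
    next
      case False
      then have "is_pivot ?B f R' a b" "is_pivot ?B f R' a b'" using p by (simp_all add: piv)
      then show ?thesis by (rule distinct)
    qed
  qed
  then show ?thesis using piv by (intro exI[of _ R]) simp
qed

lemma BD_lefschetz_quotient:
  fixes X :: "('a, 'k::field) complex_data"
  assumes X: "lefschetz_complex X" and f: "lefschetz_filter X f" and st: "(s, t) \<in> SH X f"
  shows "BD (lefschetz_quotient X (s, t)) f = BD X f - {(s, t)}"
proof -
  let ?Q = "lefschetz_quotient X (s, t)"
  have fin: "finite (cells X)" and inj: "inj_on f (cells X)"
    using X f by (auto simp: lefschetz_complex_def lefschetz_filter_def)
  note lift = reduced_form_of_quotient[OF X f st]
  show ?thesis
  proof (intro equalityI subrelI)
    fix a b assume "(a, b) \<in> BD ?Q f"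
    then obtain R' where R': "reduced_form ?Q f R'" "is_pivot (cells X - {s, t}) f R' a b"
      by (auto simp: BD_def cells_lefschetz_quotient)
    then have "(a, b) \<in> BD X f" using lift[OF R'(1)] by (auto simp: BD_def)
    moreover have "(a, b) \<noteq> (s, t)" using R'(2) by (auto simp: is_pivot_def)
    ultimately show "(a, b) \<in> BD X f - {(s, t)}" by simp
  next
    fix a b assume "(a, b) \<in> BD X f - {(s, t)}"
    then have ab: "(a, b) \<in> BD X f" "(a, b) \<noteq> (s, t)" by simp_all
    then obtain R1 where R1: "reduced_form X f R1" "is_pivot (cells X) f R1 a b"
      by (auto simp: BD_def)
    obtain R' where R': "reduced_form ?Q f R'"
      using reduced_form_exists[of ?Q f] fin inj
      by (auto simp: cells_lefschetz_quotient intro: inj_on_subset)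
    then obtain R where R: "reduced_form X f R" "is_pivot (cells X) f R a b \<longleftrightarrow>
        is_pivot (cells X - {s, t}) f R' a b \<or> (a, b) = (s, t)"
      using lift by blast
    have "is_pivot (cells X) f R a b"
      using is_pivot_reduced_form_unique[OF fin inj R1(1) R(1) R1(2)] .
    then show "(a, b) \<in> BD ?Q f" using R(2) R' ab by (auto simp: BD_def cells_lefschetz_quotient)
  qed
qed

theorem theorem6p2:
  fixes X :: "('a, 'k::field) complex_data"
    and f :: "'a \<Rightarrow> real"
    and \<sigma> :: "'a \<times> 'a"
  assumes "lefschetz_complex X"
    and "lefschetz_filter X f"
    and "\<sigma> \<in> SH X f"
  shows "SH (lefschetz_quotient X \<sigma>) f \<supseteq> SH X f - {\<sigma>} \<and>
         BD (lefschetz_quotient X \<sigma>) f = BD X f - {\<sigma>} \<and>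
         BD (lefschetz_quotient X \<sigma>) f \<inter> SH X f \<subseteq> SH (lefschetz_quotient X \<sigma>) f"
proof -
  obtain s t where \<sigma>: "\<sigma> = (s, t)" by (cases \<sigma>)
  then have sh: "(s, t) \<in> SH X f" using assms(3) by simp
  show ?thesis
    using SH_lefschetz_quotient_supset[OF assms(1,2) sh] BD_lefschetz_quotient[OF assms(1,2) sh]
    unfolding \<sigma> by blast
qed

end
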